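(* Let $C\subset\mathbb{R}^n$ be a polytope combinatorially equivalent to the $n$-dimensional hypercube. Then $\text{mono-diam}(C)=n$. Furthermore, for a given nondegenerate linear objective function there exists an ordering of the $2n$ facets of $C$ such that the simplex method with Bland's pivot rule reaches the optimal solution in at most $n$ steps from any initial vertex.
   Context: For a polytope $Q$, a linear objective function $c$ (to be minimized) is nondegenerate if no two vertices of $Q$ have the same objective value; each edge of $Q$ is then oriented toward its endpoint of smaller value. A $c$-monotone path is a directed path in this oriented graph from some vertex to the optimal vertex; its length is its number of edges. The $c$-monotone diameter of $Q$ is the maximum, over all starting vertices, of the length of a shortest $c$-monotone path from that vertex. The monotone diameter $\text{mono-diam}(Q)$ is the maximum of the $c$-monotone diameters over all nondegenerate linear objectives $c$. Bland's rule for an ordering $F_1,\dots,F_{2n}$ of the facets: one variable (slack) per facet. Each vertex $x$ of $C$ lies on exactly $n$ facets, and for each facet $F_i\ni x$ there is a unique edge at $x$ not contained in $F_i$ (the edge along which the slack of $F_i$ enters the basis). At a non-optimal vertex, Bland's rule follows the edge corresponding to the smallest index $i$ (with $x\in F_i$) for which this edge is improving. *)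

theory Defs
  imports "HOL-Analysis.Analysis"
begin

text \<open>Isomorphism of face lattices; \<open>face_of\<close> counts both the empty set and the polytope itself
  as faces.\<close>

definition combinatorially_equivalent ::
    "'a::euclidean_space set \<Rightarrow> 'b::euclidean_space set \<Rightarrow> bool" where
  "combinatorially_equivalent P Q \<longleftrightarrow>
    (\<exists>f. bij_betw f {F. F face_of P} {G. G face_of Q} \<and>
         (\<forall>F G. F face_of P \<longrightarrow> G face_of P \<longrightarrow> (F \<subseteq> G \<longleftrightarrow> f F \<subseteq> f G)))"

text \<open>A linear objective is given by a vector \<open>c\<close> and is minimized.\<close>

definition nondegenerate :: "'a::euclidean_space set \<Rightarrow> 'a \<Rightarrow> bool" where
  "nondegenerate P c \<longleftrightarrow> inj_on (\<lambda>x. c \<bullet> x) {x. x extreme_point_of P}"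

definition optimal_vertex :: "'a::euclidean_space set \<Rightarrow> 'a \<Rightarrow> 'a \<Rightarrow> bool" where
  "optimal_vertex P c w \<longleftrightarrow> w extreme_point_of P \<and> (\<forall>x\<in>P. c \<bullet> w \<le> c \<bullet> x)"

definition adjacent :: "'a::euclidean_space set \<Rightarrow> 'a \<Rightarrow> 'a \<Rightarrow> bool" where
  "adjacent P x y \<longleftrightarrow>
    x extreme_point_of P \<and> y extreme_point_of P \<and> closed_segment x y edge_of P"

definition improving :: "'a::euclidean_space set \<Rightarrow> 'a \<Rightarrow> 'a \<Rightarrow> 'a \<Rightarrow> bool" where
  "improving P c x y \<longleftrightarrow> adjacent P x y \<and> c \<bullet> y < c \<bullet> x"

definition monotone_path :: "'a::euclidean_space set \<Rightarrow> 'a \<Rightarrow> 'a \<Rightarrow> 'a list \<Rightarrow> bool" where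
  "monotone_path P c x p \<longleftrightarrow>
    p \<noteq> [] \<and> hd p = x \<and> x extreme_point_of P \<and>
    optimal_vertex P c (last p) \<and> successively (improving P c) p"

text \<open>A path visiting \<open>k + 1\<close> vertices has length \<open>k\<close>. For nondegenerate \<open>c\<close> on a nonempty polytope
  every vertex starts a monotone path, and all lengths are bounded by the number of vertices, so the
  minimum and the two maxima below are attained.\<close>

definition monotone_distance :: "'a::euclidean_space set \<Rightarrow> 'a \<Rightarrow> 'a \<Rightarrow> nat" where
  "monotone_distance P c x = (LEAST k. \<exists>p. monotone_path P c x p \<and> length p = Suc k)"

definition monotone_diameter :: "'a::euclidean_space set \<Rightarrow> 'a \<Rightarrow> nat" where
  "monotone_diameter P c = Max (monotone_distance P c ` {x. x extreme_point_of P})"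

definition mono_diam :: "'a::euclidean_space set \<Rightarrow> nat" where
  "mono_diam P = Max (monotone_diameter P ` {c. nondegenerate P c})"

definition facet_ordering :: "'a::euclidean_space set \<Rightarrow> 'a set list \<Rightarrow> bool" where
  "facet_ordering P Fs \<longleftrightarrow> distinct Fs \<and> set Fs = {F. F facet_of P}"

text \<open>The other endpoint of the edge at \<open>x\<close> not contained in the facet \<open>F\<close>, i.e. the vertex reached
  when the slack of \<open>F\<close> enters the basis. It is unique when \<open>P\<close> is simple and \<open>x \<in> F\<close>.\<close>

definition entering_vertex :: "'a::euclidean_space set \<Rightarrow> 'a set \<Rightarrow> 'a \<Rightarrow> 'a" where
  "entering_vertex P F x = (THE y. adjacent P x y \<and> \<not> closed_segment x y \<subseteq> F)"

definition bland_index :: "'a::euclidean_space set \<Rightarrow> 'a \<Rightarrow> 'a set list \<Rightarrow> 'a \<Rightarrow> nat" where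
  "bland_index P c Fs x =
    (LEAST i. i < length Fs \<and> x \<in> Fs ! i \<and> improving P c x (entering_vertex P (Fs ! i) x))"

definition bland_step :: "'a::euclidean_space set \<Rightarrow> 'a \<Rightarrow> 'a set list \<Rightarrow> 'a \<Rightarrow> 'a" where
  "bland_step P c Fs x =
    (if optimal_vertex P c x then x else entering_vertex P (Fs ! bland_index P c Fs x) x)"

end

theory Submission
  imports Defs
begin

text \<open>Label the vertices of \<open>C\<close> by bit vectors and let \<open>w\<close> be the optimal vertex. If \<open>v \<noteq> w\<close>, then \<open>v\<close>
  is not optimal on the smallest face containing \<open>v\<close> and \<open>w\<close>, so some improving edge at \<open>v\<close> lies in
  that face; such an edge corrects one of the bits in which \<open>v\<close> and \<open>w\<close> differ. As every edge changes
  exactly one bit, the monotone distance from \<open>v\<close> is the Hamming distance to \<open>w\<close>. The bit-correcting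
  edges at \<open>v\<close> are those leaving a facet that misses \<open>w\<close>, so it suffices to let Bland's rule list the
  facets that miss \<open>w\<close> first.\<close>

section \<open>Faces and vertices of polytopes\<close>

text \<open>The minimizers of \<open>c\<close> form a nonempty compact face, and an extreme point of
  a face is extreme in \<open>P\<close>.\<close>

lemma polytope_minimizing_vertex:
  fixes P :: "'a::euclidean_space set"
  assumes "polytope P" "P \<noteq> {}"
  obtains w where "w extreme_point_of P" "\<And>x. x \<in> P \<Longrightarrow> c \<bullet> w \<le> c \<bullet> x"
proof -
  have "compact P" "convex P"
    using assms polytope_imp_compact polytope_imp_convex by auto
  have "\<exists>u\<in>P. \<forall>x\<in>P. c \<bullet> u \<le> c \<bullet> x"
    using \<open>compact P\<close> assms(2) by (intro continuous_attains_inf continuous_intros)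
  then obtain u where u: "u \<in> P" "\<And>x. x \<in> P \<Longrightarrow> c \<bullet> u \<le> c \<bullet> x"
    by blast
  let ?F = "P \<inter> {x. c \<bullet> x = c \<bullet> u}"
  have F: "?F face_of P"
    using \<open>convex P\<close> u(2) by (intro face_of_Int_supporting_hyperplane_ge)
  have "compact ?F" "convex ?F" "?F \<noteq> {}"
    using face_of_imp_compact[OF \<open>convex P\<close> \<open>compact P\<close> F] face_of_imp_convex[OF F] u(1) by auto
  then obtain w where "w extreme_point_of ?F"
    using extreme_point_exists_convex by blast
  then have "w extreme_point_of P" "c \<bullet> w = c \<bullet> u"
    using extreme_point_of_face[OF F] by auto
  then show thesis
    using that u(2) by simp
qed

lemma polytope_face_eq_hull:
  fixes P :: "'a::euclidean_space set"
  assumes "polytope P" "F face_of P"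
  shows "F = convex hull {v. v extreme_point_of P \<and> v \<in> F}"
proof -
  have "polytope F" using assms face_of_polytope_polytope by blast
  then have "F = convex hull {v. v extreme_point_of F}"
    by (simp add: Krein_Milman_Minkowski polytope_imp_compact polytope_imp_convex)
  then show ?thesis using extreme_point_of_face[OF assms(2)] by simp
qed

lemma finite_extreme_points_polytope:
  fixes P :: "'a::euclidean_space set"
  shows "polytope P \<Longrightarrow> finite {v. v extreme_point_of P}"
  by (simp add: finite_polyhedron_extreme_points polytope_imp_polyhedron)

text \<open>Turns adjacency into a question about which vertices lie in a face: a face is the hull
  of its vertices, so a face with exactly two vertices is the segment between them.\<close>

lemma adjacent_iff_face:
  assumes "polytope P" "u extreme_point_of P" "v extreme_point_of P" "u \<noteq> v"
  shows "adjacent P u v \<longleftrightarrow>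
    (\<exists>F. F face_of P \<and> {x. x extreme_point_of P \<and> x \<in> F} = {u, v})"
proof
  assume "adjacent P u v"
  then have F: "closed_segment u v face_of P"
    by (auto simp: adjacent_def edge_of_def)
  then have "{x. x extreme_point_of P \<and> x \<in> closed_segment u v} = {u, v}"
    using extreme_point_of_face[OF F] extreme_point_of_segment by blast
  then show "\<exists>F. F face_of P \<and> {x. x extreme_point_of P \<and> x \<in> F} = {u, v}"
    using F by blast
next
  assume "\<exists>F. F face_of P \<and> {x. x extreme_point_of P \<and> x \<in> F} = {u, v}"
  then obtain F where "F face_of P" "F = convex hull {u, v}"
    using polytope_face_eq_hull[OF assms(1)] by metis
  then show "adjacent P u v"
    using assms by (simp add: adjacent_def edge_of_def segment_convex_hull aff_dim_convex_hull aff_dim_2)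
qed

text \<open>With \<open>a \<bullet> y \<le> b\<close> exposing \<open>x\<close>, the face \<open>E\<close> consists of \<open>x\<close> and the points of steepest descent
  \<open>(c \<bullet> x - c \<bullet> y) / (b - a \<bullet> y)\<close>.\<close>

lemma polytope_improving_face:
  fixes P :: "'a::euclidean_space set"
  assumes P: "polytope P" and x: "x extreme_point_of P" and w: "w \<in> P" "c \<bullet> w < c \<bullet> x"
  obtains E where "E face_of P" "x \<in> E" "E \<noteq> {x}" "\<forall>y\<in>E. y \<noteq> x \<longrightarrow> c \<bullet> y < c \<bullet> x"
proof -
  have xP: "x \<in> P" using x by (simp add: extreme_point_of_def)
  have cvx: "convex P" using P polytope_imp_convex by blast
  have "{x} exposed_face_of P"
    using x P by (simp add: exposed_face_of_polyhedron face_of_singleton polytope_imp_polyhedron)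
  then obtain a b where ab: "\<And>y. y \<in> P \<Longrightarrow> a \<bullet> y \<le> b" "{x} = P \<inter> {y. a \<bullet> y = b}"
    unfolding exposed_face_of_def by blast
  have ax: "a \<bullet> x = b" using ab(2) by blast
  have lt: "a \<bullet> y < b" if "y \<in> P" "y \<noteq> x" for y
    using ab that by (metis (mono_tags) IntI less_eq_real_def mem_Collect_eq singletonD)
  define V where "V = {v. v extreme_point_of P} - {x}"
  define r where "r v = (c \<bullet> x - c \<bullet> v) / (b - a \<bullet> v)" for v
  have VP: "v \<in> P" "v \<noteq> x" if "v \<in> V" for v
    using that by (auto simp: V_def extreme_point_of_def)
  have fin: "finite V" using P by (simp add: V_def finite_extreme_points_polytope)
  \<comment> \<open>The point \<open>w\<close> need not be a vertex; a minimizing vertex lies at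
    least as low and yields one positive rate, hence \<open>0 < \<rho>\<close>.\<close>
  obtain v0 where v0: "v0 extreme_point_of P" "\<And>y. y \<in> P \<Longrightarrow> c \<bullet> v0 \<le> c \<bullet> y"
    using polytope_minimizing_vertex P xP by (metis empty_iff)
  have v0V: "v0 \<in> V" and v0c: "c \<bullet> v0 < c \<bullet> x"
    using v0(1) v0(2)[OF w(1)] w(2) by (auto simp: V_def)
  define \<rho> where "\<rho> = Max (r ` V)"
  have "\<rho> \<in> r ` V" unfolding \<rho>_def using fin v0V by (intro Max_in) auto
  then obtain m where m: "m \<in> V" "\<rho> = r m" by blast
  have le: "r v \<le> \<rho>" if "v \<in> V" for v
    unfolding \<rho>_def using fin that by simp
  have "0 < r v0" using lt[OF VP[OF v0V]] v0c by (simp add: r_def)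
  then have \<rho>: "0 < \<rho>" using le[OF v0V] by linarith
  \<comment> \<open>At a vertex \<open>v \<noteq> x\<close>,
    \<open>d \<bullet> v \<le> d \<bullet> x\<close> is \<open>r v \<le> \<rho>\<close> with the
    denominator cleared, so \<open>d\<close> supports \<open>P\<close> at \<open>x\<close> and is
    tight where the rate is largest.\<close>
  define d where "d = \<rho> *\<^sub>R a - c"
  have "d \<bullet> v \<le> d \<bullet> x" if "v extreme_point_of P" for v
  proof (cases "v = x")
    case False
    then have "v \<in> V" using that by (simp add: V_def)
    then have "(c \<bullet> x - c \<bullet> v) / (b - a \<bullet> v) \<le> \<rho>" "a \<bullet> v < b"
      using le[of v] lt VP by (auto simp: r_def)
    then show ?thesis
      by (simp add: d_def ax inner_diff_left divide_simps algebra_simps)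
  qed simp
  then have "convex hull {v. v extreme_point_of P} \<subseteq> {y. d \<bullet> y \<le> d \<bullet> x}"
    by (intro hull_minimal convex_halfspace_le) auto
  then have dle: "d \<bullet> y \<le> d \<bullet> x" if "y \<in> P" for y
    using that Krein_Milman_Minkowski[OF polytope_imp_compact[OF P] cvx] by blast
  define E where "E = P \<inter> {y. d \<bullet> y = d \<bullet> x}"
  show thesis
  proof
    show "E face_of P"
      unfolding E_def using cvx dle by (rule face_of_Int_supporting_hyperplane_le)
    show "x \<in> E" using xP by (simp add: E_def)
    have "m \<in> E"
      using m VP[OF m(1)] lt[OF VP[OF m(1)]]
      by (simp add: E_def d_def r_def inner_diff_left ax field_simps)
    then show "E \<noteq> {x}" using VP(2)[OF m(1)] by blast
    show "\<forall>y\<in>E. y \<noteq> x \<longrightarrow> c \<bullet> y < c \<bullet> x"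
    proof (intro ballI impI)
      fix y assume that: "y \<in> E" "y \<noteq> x"
      have "c \<bullet> x - c \<bullet> y = \<rho> * (b - a \<bullet> y)"
        using that by (simp add: E_def d_def inner_diff_left ax algebra_simps)
      moreover have "0 < \<rho> * (b - a \<bullet> y)"
        using that \<rho> lt by (simp add: E_def)
      ultimately show "c \<bullet> y < c \<bullet> x" by linarith
    qed
  qed
qed

text \<open>Describes facets by inclusion of faces alone, which a lattice isomorphism preserves. A
  face strictly between \<open>F\<close> and \<open>P\<close> would need a dimension strictly
  between theirs; conversely, a proper nonempty face lies in some facet.\<close>

lemma facet_of_iff_maximal_face:
  fixes P :: "'a::euclidean_space set"
  assumes "polytope P" "F \<noteq> {}"
  shows "F facet_of P \<longleftrightarrow> F face_of P \<and> F \<noteq> P \<and>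
    (\<forall>G. G face_of P \<longrightarrow> F \<subseteq> G \<longrightarrow> G = F \<or> G = P)"
proof
  assume F: "F facet_of P"
  have cvx: "convex P" using assms(1) polytope_imp_convex by blast
  show "F face_of P \<and> F \<noteq> P \<and> (\<forall>G. G face_of P \<longrightarrow> F \<subseteq> G \<longrightarrow> G = F \<or> G = P)"
  proof (intro conjI allI impI)
    show "F face_of P" "F \<noteq> P" using F by (auto simp: facet_of_def)
    fix G assume G: "G face_of P" "F \<subseteq> G"
    show "G = F \<or> G = P"
    proof (rule ccontr)
      assume neg: "\<not> (G = F \<or> G = P)"
      have "F face_of G"
        using face_of_subset[of F P G] F G face_of_imp_subset[OF G(1)] by (simp add: facet_of_def)
      then have "aff_dim F < aff_dim G" "aff_dim G < aff_dim P"
        using neg G cvx face_of_imp_convex by (auto intro!: face_of_aff_dim_lt)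
      then show False using F by (simp add: facet_of_def)
    qed
  qed
next
  assume F: "F face_of P \<and> F \<noteq> P \<and> (\<forall>G. G face_of P \<longrightarrow> F \<subseteq> G \<longrightarrow> G = F \<or> G = P)"
  then obtain G where "G facet_of P" "F \<subseteq> G"
    using face_of_polyhedron_subset_facet[OF polytope_imp_polyhedron[OF assms(1)] _ assms(2)]
    by metis
  moreover from this have "G face_of P" "G \<noteq> P" by (auto simp: facet_of_def)
  ultimately show "F facet_of P" using F by metis
qed

text \<open>The degenerate objectives lie in finitely many hyperplanes, one orthogonal to each
  difference of two vertices, and these cannot cover the space. This keeps the maximum in
  \<open>mono_diam\<close> from ranging over the empty set.\<close>

lemma nondegenerate_exists:
  fixes P :: "'a::euclidean_space set"
  assumes "polytope P"
  shows "\<exists>c. nondegenerate P c"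
proof -
  let ?V = "{v. v extreme_point_of P}"
  let ?H = "(\<lambda>(u, v). {c. (u - v) \<bullet> c = 0}) ` {(u, v) \<in> ?V \<times> ?V. u \<noteq> v}"
  have "finite (?V \<times> ?V)"
    using assms finite_extreme_points_polytope by blast
  then have "finite {(u, v) \<in> ?V \<times> ?V. u \<noteq> v}"
    by (rule rev_finite_subset) auto
  then have "negligible (\<Union>?H)"
    by (intro negligible_Union finite_imageI) (auto intro!: negligible_hyperplane)
  then have "\<Union>?H \<noteq> UNIV" using non_negligible_UNIV by metis
  then obtain c where c: "c \<notin> \<Union>?H" by blast
  have "nondegenerate P c"
    unfolding nondegenerate_def
  proof (rule inj_onI, rule ccontr)
    fix u v assume "u \<in> ?V" "v \<in> ?V" "c \<bullet> u = c \<bullet> v" "u \<noteq> v"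
    then have "{c. (u - v) \<bullet> c = 0} \<in> ?H" "c \<in> {c. (u - v) \<bullet> c = 0}"
      by (auto simp: inner_commute[of _ c] inner_diff_right)
    then have "c \<in> \<Union>?H" by (rule UnionI)
    with c show False by contradiction
  qed
  then show ?thesis by blast
qed

section \<open>Faces of the cube\<close>

text \<open>A coordinate strictly between 0 and 1 can be moved both ways, so \<open>x\<close> is
  inside a segment. Conversely, a mixture with positive weights of numbers in [0, 1] equals 0 or 1
  only if both numbers do.\<close>

lemma cube_vertex_iff:
  fixes x :: "real ^ 'n"
  shows "x extreme_point_of cbox 0 1 \<longleftrightarrow> (\<forall>i. x $ i = 0 \<or> x $ i = 1)"
proof
  assume x: "x extreme_point_of cbox 0 1"
  show "\<forall>i. x $ i = 0 \<or> x $ i = 1"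
  proof (rule ccontr)
    assume "\<not> ?thesis"
    then obtain i where i: "x $ i \<noteq> 0" "x $ i \<noteq> 1" by blast
    have xc: "0 \<le> x $ j" "x $ j \<le> 1" for j
      using x by (simp_all add: extreme_point_of_def mem_box_cart)
    define e where "e t = (\<chi> j. if j = i then t else x $ j)" for t
    have "e 0 \<in> cbox 0 1" "e 1 \<in> cbox 0 1"
      using xc by (simp_all add: e_def mem_box_cart)
    moreover have "x \<in> open_segment (e 0) (e 1)"
      unfolding in_segment
    proof (intro conjI exI)
      show "e 0 \<noteq> e 1" by (auto simp: e_def vec_eq_iff)
      show "0 < x $ i" "x $ i < 1" using xc[of i] i by auto
      show "x = (1 - x $ i) *\<^sub>R e 0 + x $ i *\<^sub>R e 1"
        by (simp add: e_def vec_eq_iff algebra_simps)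
    qed
    ultimately show False using x by (auto simp: extreme_point_of_def)
  qed
next
  assume x: "\<forall>i. x $ i = 0 \<or> x $ i = 1"
  have "x \<notin> open_segment a b" if ab: "a \<in> cbox 0 1" "b \<in> cbox 0 1" for a b
  proof
    assume "x \<in> open_segment a b"
    then obtain t where t: "a \<noteq> b" "0 < t" "t < 1" "x = (1 - t) *\<^sub>R a + t *\<^sub>R b"
      by (auto simp: in_segment)
    have "a $ i = b $ i" for i
    proof -
      have xi: "x $ i = (1 - t) * a $ i + t * b $ i" using t(4) by simp
      have ab': "0 \<le> a $ i" "a $ i \<le> 1" "0 \<le> b $ i" "b $ i \<le> 1"
        using ab by (simp_all add: mem_box_cart)
      have "x $ i = 0 \<or> x $ i = 1" using x by blast
      then show ?thesis
      proof
        assume "x $ i = 0"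
        moreover have "0 \<le> (1 - t) * a $ i" "0 \<le> t * b $ i" using ab' t by auto
        ultimately have "(1 - t) * a $ i = 0" "t * b $ i = 0" using xi by linarith+
        then show ?thesis using t by simp
      next
        assume "x $ i = 1"
        then have "(1 - t) * (1 - a $ i) + t * (1 - b $ i) = 0"
          using xi by (simp add: algebra_simps)
        moreover have "0 \<le> (1 - t) * (1 - a $ i)" "0 \<le> t * (1 - b $ i)" using ab' t by auto
        ultimately have "(1 - t) * (1 - a $ i) = 0" "t * (1 - b $ i) = 0" by linarith+
        then show ?thesis using t by simp
      qed
    qed
    then show False using t(1) by (simp add: vec_eq_iff)
  qed
  moreover have "x \<in> cbox 0 1"
    unfolding mem_box_cart
  proof
    show "0 $ i \<le> x $ i \<and> x $ i \<le> 1 $ i" for i using x[rule_format, of i] by auto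
  qed
  ultimately show "x extreme_point_of cbox 0 1" by (simp add: extreme_point_of_def)
qed

definition cube_facet :: "'n \<Rightarrow> bool \<Rightarrow> (real ^ 'n) set" where
  "cube_facet i b = cbox 0 1 \<inter> {y. y $ i = of_bool b}"

definition cube_bits :: "real ^ 'n \<Rightarrow> 'n \<Rightarrow> bool" where
  "cube_bits x i \<longleftrightarrow> x $ i = 1"

definition cube_vertex :: "('n \<Rightarrow> bool) \<Rightarrow> real ^ 'n" where
  "cube_vertex s = (\<chi> i. of_bool (s i))"

lemma cube_vertex_extreme: "cube_vertex s extreme_point_of cbox 0 1"
  by (simp add: cube_vertex_iff cube_vertex_def)

lemma cube_bits_vertex [simp]: "cube_bits (cube_vertex s) = s"
  by (simp add: cube_vertex_def cube_bits_def fun_eq_iff)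

lemma cube_vertex_bits: "x extreme_point_of cbox 0 1 \<Longrightarrow> cube_vertex (cube_bits x) = x"
  by (auto simp: cube_vertex_iff cube_vertex_def cube_bits_def vec_eq_iff)

lemma cube_facet_face:
  fixes i :: "'n::finite"
  shows "cube_facet i b face_of cbox 0 1"
proof (cases b)
  case True
  have "cbox 0 1 \<inter> {y. axis i 1 \<bullet> y = 1} face_of (cbox 0 1 :: (real ^ 'n) set)"
    by (rule face_of_Int_supporting_hyperplane_le) (auto simp: inner_axis' mem_box_cart)
  then show ?thesis using True by (simp add: cube_facet_def inner_axis')
next
  case False
  have "cbox 0 1 \<inter> {y. axis i 1 \<bullet> y = 0} face_of (cbox 0 1 :: (real ^ 'n) set)"
    by (rule face_of_Int_supporting_hyperplane_ge) (auto simp: inner_axis' mem_box_cart)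
  then show ?thesis using False by (simp add: cube_facet_def inner_axis')
qed

lemma cube_vertex_in_facet_iff: "cube_vertex s \<in> cube_facet i b \<longleftrightarrow> s i = b"
  using cube_vertex_extreme[of s]
  by (auto simp: cube_facet_def cube_vertex_def extreme_point_of_def)

text \<open>Incomparability, combined with \<open>cube_proper_face_subset_facet\<close>, singles out
  the \<open>cube_facet i b\<close> as the maximal proper faces.\<close>

lemma cube_facet_subset_iff: "cube_facet i b \<subseteq> cube_facet j b' \<longleftrightarrow> i = j \<and> b = b'"
proof
  assume sub: "cube_facet i b \<subseteq> cube_facet j b'"
  \<comment> \<open>Bit \<open>i\<close> places the vertex in the first facet; all other bits avoid
    \<open>b'\<close>, so lying in the second facet forces \<open>j = i\<close>.\<close>
  let ?s = "(\<lambda>_. \<not> b')(i := b)"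
  have "cube_vertex ?s \<in> cube_facet i b" by (simp add: cube_vertex_in_facet_iff)
  then have "cube_vertex ?s \<in> cube_facet j b'" using sub by blast
  then have "?s j = b'" by (simp only: cube_vertex_in_facet_iff)
  then show "i = j \<and> b = b'"
    by (auto split: if_splits)
qed simp

lemma cube_facet_proper:
  fixes i :: "'n::finite"
  shows "cube_facet i b \<noteq> cbox 0 1"
proof
  assume "cube_facet i b = cbox 0 1"
  then have "cube_vertex (\<lambda>_. \<not> b) \<in> cube_facet i b"
    using cube_vertex_extreme[of "\<lambda>_ :: 'n. \<not> b"] by (simp add: extreme_point_of_def)
  then show False by (simp add: cube_vertex_in_facet_iff)
qed

text \<open>A proper face misses the interior, so each of its points has a coordinate 0 or 1. For a
  point in the relative interior of \<open>F\<close>, the facet given by that coordinate contains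
  all of \<open>F\<close>.\<close>

lemma cube_proper_face_subset_facet:
  fixes F :: "(real ^ 'n) set"
  assumes F: "F face_of cbox 0 1" "F \<noteq> cbox 0 1"
  shows "\<exists>i b. F \<subseteq> cube_facet i b"
proof (cases "F = {}")
  case False
  then obtain z where z: "z \<in> rel_interior F"
    using F face_of_imp_convex rel_interior_eq_empty by blast
  then have zF: "z \<in> F" using rel_interior_subset by blast
  then have zc: "z \<in> cbox 0 1" using F(1) face_of_imp_subset by blast
  have "z \<notin> box 0 1"
    using face_of_disjoint_interior[OF F] zF by (auto simp: interior_cbox)
  then obtain i where "\<not> (0 < z $ i \<and> z $ i < 1)"
    by (auto simp: mem_box_cart)
  moreover have "0 \<le> z $ i" "z $ i \<le> 1" using zc by (simp_all add: mem_box_cart)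
  ultimately have "z $ i = of_bool (z $ i = 1)" by auto
  then have "z \<in> cube_facet i (z $ i = 1)"
    using zc by (simp add: cube_facet_def)
  then show ?thesis
    using subset_of_face_of[OF cube_facet_face face_of_imp_subset[OF F(1)]] z by blast
qed simp

text \<open>Both pairs of opposite corners of a rectangle have the same midpoint.\<close>

lemma cube_face_flip:
  assumes F: "F face_of cbox 0 1" and mem: "cube_vertex s \<in> F" "cube_vertex t \<in> F"
    and ne: "s i \<noteq> t i"
  shows "cube_vertex (t(i := s i)) \<in> F"
proof -
  let ?a = "cube_vertex (s(i := t i))" and ?b = "cube_vertex (t(i := s i))"
  have "midpoint (cube_vertex s) (cube_vertex t) \<in> F"
    using mem F by (meson convex_contains_segment face_of_imp_convex midpoint_in_closed_segment subsetD)
  moreover have "midpoint (cube_vertex s) (cube_vertex t) = midpoint ?a ?b"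
    by (auto simp: midpoint_def cube_vertex_def vec_eq_iff)
  \<comment> \<open>Distinct corners have their midpoint in the open segment, as the defining
    property of a face requires.\<close>
  moreover have "?a \<noteq> ?b"
    using ne by (metis cube_bits_vertex fun_upd_same)
  ultimately have "midpoint ?a ?b \<in> F" "midpoint ?a ?b \<in> open_segment ?a ?b" by auto
  moreover have "?a \<in> cbox 0 1" "?b \<in> cbox 0 1"
    using cube_vertex_extreme by (auto simp: extreme_point_of_def)
  ultimately show ?thesis using face_ofD[OF F] by blast
qed

section \<open>Transfer along face lattice isomorphisms\<close>

definition face_isomorphism ::
    "('a::euclidean_space set \<Rightarrow> 'b::euclidean_space set) \<Rightarrow> 'a set \<Rightarrow> 'b set \<Rightarrow> bool" where
  "face_isomorphism f P Q \<longleftrightarrow>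
    bij_betw f {F. F face_of P} {G. G face_of Q} \<and>
    (\<forall>F G. F face_of P \<longrightarrow> G face_of P \<longrightarrow> (F \<subseteq> G \<longleftrightarrow> f F \<subseteq> f G))"

lemma combinatorially_equivalent_iff:
  "combinatorially_equivalent P Q \<longleftrightarrow> (\<exists>f. face_isomorphism f P Q)"
  by (simp add: combinatorially_equivalent_def face_isomorphism_def)

lemma face_isomorphism_subset_iff:
  "face_isomorphism f P Q \<Longrightarrow> F face_of P \<Longrightarrow> G face_of P \<Longrightarrow> f F \<subseteq> f G \<longleftrightarrow> F \<subseteq> G"
  by (simp add: face_isomorphism_def)

lemma face_isomorphism_face: "face_isomorphism f P Q \<Longrightarrow> F face_of P \<Longrightarrow> f F face_of Q"
  unfolding face_isomorphism_def bij_betw_def by blast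

lemma face_isomorphism_inverse:
  assumes "face_isomorphism f P Q"
  obtains g where "face_isomorphism g Q P" "\<And>F. F face_of P \<Longrightarrow> g (f F) = F"
    "\<And>G. G face_of Q \<Longrightarrow> f (g G) = G"
proof
  let ?g = "inv_into {F. F face_of P} f"
  have bij: "bij_betw f {F. F face_of P} {G. G face_of Q}"
    using assms by (simp add: face_isomorphism_def)
  have gbij: "bij_betw ?g {G. G face_of Q} {F. F face_of P}"
    using bij by (rule bij_betw_inv_into)
  show gf: "?g (f F) = F" if "F face_of P" for F
    using bij_betw_inv_into_left[OF bij] that by simp
  show fg: "f (?g G) = G" if "G face_of Q" for G
    using bij_betw_inv_into_right[OF bij] that by simp
  have gface: "?g G face_of P" if "G face_of Q" for G
    using bij_betw_apply[OF gbij] that by blast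
  show "face_isomorphism ?g Q P"
    unfolding face_isomorphism_def
  proof (intro conjI allI impI)
    fix F G assume FG: "F face_of Q" "G face_of Q"
    show "F \<subseteq> G \<longleftrightarrow> ?g F \<subseteq> ?g G"
      using face_isomorphism_subset_iff[OF assms gface[OF FG(1)] gface[OF FG(2)]]
      by (simp only: fg FG)
  qed (fact gbij)
qed

text \<open>The empty face is the least element of the lattice, and order isomorphisms preserve
  least elements.\<close>

lemma face_isomorphism_empty:
  assumes "face_isomorphism f P Q"
  shows "f {} = {}"
proof -
  obtain g where g: "face_isomorphism g Q P" "\<And>G. G face_of Q \<Longrightarrow> f (g G) = G"
    using face_isomorphism_inverse[OF assms] by metis
  have "g {} face_of P"
    using face_isomorphism_face[OF g(1)] by simp
  then have "f {} \<subseteq> f (g {})"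
    using face_isomorphism_subset_iff[OF assms] by simp
  then show ?thesis by (simp add: g(2))
qed

lemma face_isomorphism_top:
  assumes "face_isomorphism f P Q" "convex P" "convex Q"
  shows "f P = Q"
proof -
  obtain g where g: "face_isomorphism g Q P" "\<And>G. G face_of Q \<Longrightarrow> f (g G) = G"
    using face_isomorphism_inverse[OF assms(1)] by metis
  have P: "P face_of P" and Q: "Q face_of Q" using assms by (simp_all add: face_of_refl)
  have "g Q face_of P" by (rule face_isomorphism_face[OF g(1) Q])
  then have "f (g Q) \<subseteq> f P"
    using face_isomorphism_subset_iff[OF assms(1) _ P] face_of_imp_subset by blast
  moreover have "f P \<subseteq> Q"
    using face_isomorphism_face[OF assms(1) P] by (rule face_of_imp_subset)
  ultimately show ?thesis by (simp add: g(2) Q)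
qed

text \<open>Vertices are the atoms of the face lattice: the nonempty face \<open>f {v}\<close> has a
  vertex \<open>u\<close>, and pulling \<open>{u}\<close> back gives a nonempty face inside
  \<open>{v}\<close>.\<close>

lemma face_isomorphism_vertex:
  assumes f: "face_isomorphism f P Q" and "polytope Q" and v: "v extreme_point_of P"
  shows "\<exists>u. u extreme_point_of Q \<and> f {v} = {u}"
proof -
  obtain g where g: "face_isomorphism g Q P" "\<And>F. F face_of P \<Longrightarrow> g (f F) = F"
      "\<And>G. G face_of Q \<Longrightarrow> f (g G) = G"
    using face_isomorphism_inverse[OF f] by metis
  have vP: "{v} face_of P" using v by (simp add: face_of_singleton)
  have fv: "f {v} face_of Q" by (rule face_isomorphism_face[OF f vP])
  have "f {v} \<noteq> {}"
    using g(2)[OF vP] face_isomorphism_empty[OF g(1)] by auto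
  moreover have "polytope (f {v})"
    using fv assms(2) face_of_polytope_polytope by blast
  ultimately obtain u where "u extreme_point_of f {v}"
    using polytope_minimizing_vertex by metis
  then have u: "u extreme_point_of Q" "{u} \<subseteq> f {v}"
    using extreme_point_of_face[OF fv] by auto
  have uQ: "{u} face_of Q" using u(1) by (simp add: face_of_singleton)
  have gu: "g {u} \<subseteq> {v}"
    using u(2) face_isomorphism_subset_iff[OF g(1) uQ fv] by (simp add: g(2)[OF vP])
  have "g {u} \<noteq> {}"
    using g(3)[OF uQ] face_isomorphism_empty[OF f] by auto
  then have "g {u} = {v}" using gu by blast
  then have "f {v} = {u}" using g(3)[OF uQ] by simp
  then show ?thesis using u(1) by blast
qed

text \<open>The combinatorial content of being a cube. \<open>face_flip\<close> carries over
  \<open>cube_face_flip\<close>: its midpoint argument works only in the standard cube, but its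
  conclusion speaks only of vertices in faces.\<close>

locale cube_labelling =
  fixes C :: "'a::euclidean_space set"
    and bits :: "'a \<Rightarrow> 'n::finite \<Rightarrow> bool"
    and Fac :: "'n \<Rightarrow> bool \<Rightarrow> 'a set"
  assumes polytope: "polytope C"
    and bij_bits: "bij_betw bits {v. v extreme_point_of C} UNIV"
    and bij_facets: "bij_betw (\<lambda>(i, b). Fac i b) UNIV {F. F facet_of C}"
    and vertex_in_facet_iff: "v extreme_point_of C \<Longrightarrow> v \<in> Fac i b \<longleftrightarrow> bits v i = b"
    and face_flip: "\<lbrakk>F face_of C; u extreme_point_of C; v extreme_point_of C; u \<in> F; v \<in> F;
      bits u i \<noteq> bits v i; v' extreme_point_of C; bits v' = (bits v)(i := bits u i)\<rbrakk> \<Longrightarrow> v' \<in> F"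

text \<open>Bits are the coordinates of the corresponding vertex of the standard cube, and
  \<open>Fac i b\<close> is the face corresponding to \<open>cube_facet i b\<close>.\<close>

lemma cube_labelling_exists:
  fixes C :: "'a::euclidean_space set"
  assumes C: "polytope C" and "combinatorially_equivalent C (cbox 0 1 :: (real ^ 'n) set)"
  shows "\<exists>(bits :: 'a \<Rightarrow> 'n \<Rightarrow> bool) Fac. cube_labelling C bits Fac"
proof -
  let ?Q = "cbox 0 1 :: (real ^ 'n) set"
  obtain f where f: "face_isomorphism f C ?Q"
    using assms(2) combinatorially_equivalent_iff by blast
  obtain g where g: "face_isomorphism g ?Q C" "\<And>F. F face_of C \<Longrightarrow> g (f F) = F"
      "\<And>G. G face_of ?Q \<Longrightarrow> f (g G) = G"
    using face_isomorphism_inverse[OF f] by metis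
  have Q: "polytope ?Q" by (rule polytope_interval)
  have fC: "f C = ?Q"
    using f C Q by (intro face_isomorphism_top polytope_imp_convex)
  define bits where "bits v = cube_bits (the_elem (f {v}))" for v
  define Fac where "Fac i b = g (cube_facet i b)" for i b
  have f_vertex: "f {v} = {cube_vertex (bits v)}" if "v extreme_point_of C" for v
  proof -
    obtain u where u: "u extreme_point_of ?Q" "f {v} = {u}"
      using face_isomorphism_vertex[OF f Q \<open>v extreme_point_of C\<close>] by metis
    then have "bits v = cube_bits u" by (simp only: bits_def the_elem_eq)
    then show ?thesis using u cube_vertex_bits by metis
  qed
  \<comment> \<open>Membership of a vertex is the inclusion \<open>{v} \<subseteq> F\<close> between
    faces, which \<open>f\<close> preserves.\<close>
  have mem_face_iff: "v \<in> F \<longleftrightarrow> cube_vertex (bits v) \<in> f F"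
    if "v extreme_point_of C" "F face_of C" for v F
    using face_isomorphism_subset_iff[OF f _ that(2), of "{v}"] that(1) f_vertex[OF that(1)]
    by (simp add: face_of_singleton)
  have Fac_face: "Fac i b face_of C" for i b
    unfolding Fac_def by (rule face_isomorphism_face[OF g(1) cube_facet_face])
  have f_Fac: "f (Fac i b) = cube_facet i b" for i b
    unfolding Fac_def by (rule g(3)[OF cube_facet_face])
  have Fac_subset: "Fac i b \<subseteq> Fac j b' \<longleftrightarrow> i = j \<and> b = b'" for i b j b'
    using face_isomorphism_subset_iff[OF f Fac_face Fac_face, of i b j b']
    by (simp add: f_Fac cube_facet_subset_iff)
  have Fac_proper: "Fac i b \<noteq> C" for i b
    using f_Fac[of i b] fC cube_facet_proper[of i b] by metis
  have proper_face: "\<exists>i b. F \<subseteq> Fac i b" if F: "F face_of C" "F \<noteq> C" for F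
  proof -
    have "f F \<noteq> ?Q"
      using g(2)[OF F(1)] g(2)[of C] F(2) fC C by (metis face_of_refl polytope_imp_convex)
    then obtain i b where "f F \<subseteq> cube_facet i b"
      using cube_proper_face_subset_facet[OF face_isomorphism_face[OF f F(1)]] by blast
    then show ?thesis
      using face_isomorphism_subset_iff[OF f F(1) Fac_face, of i b] by (auto simp: f_Fac)
  qed
  have surj: "\<exists>v. v extreme_point_of C \<and> bits v = s" for s
  proof -
    obtain v where v: "v extreme_point_of C" "g {cube_vertex s} = {v}"
      using face_isomorphism_vertex[OF g(1) C cube_vertex_extreme] by blast
    have "f {v} = {cube_vertex s}"
      using v(2) g(3)[of "{cube_vertex s}"] by (simp add: face_of_singleton cube_vertex_extreme)
    then have "bits v = s" by (simp add: bits_def)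
    then show ?thesis using v(1) by blast
  qed
  have vertex_Fac: "v \<in> Fac i b \<longleftrightarrow> bits v i = b" if "v extreme_point_of C" for v i b
    using mem_face_iff[OF that Fac_face] by (simp add: f_Fac cube_vertex_in_facet_iff)
  \<comment> \<open>Every proper face lies in some \<open>Fac i b\<close>, and these are proper and
    pairwise incomparable, so they are exactly the maximal proper faces.\<close>
  have facets: "{F. F facet_of C} = (\<lambda>(i, b). Fac i b) ` UNIV"
  proof (intro equalityI subsetI)
    fix F assume F: "F \<in> {F. F facet_of C}"
    then have max: "F face_of C" "F \<noteq> C" "\<And>G. G face_of C \<Longrightarrow> F \<subseteq> G \<Longrightarrow> G = F \<or> G = C"
      using facet_of_iff_maximal_face[OF C, of F] by (auto simp: facet_of_def)
    then obtain i b where "F \<subseteq> Fac i b" using proper_face by blast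
    then have "F = Fac i b" using max(3)[OF Fac_face] Fac_proper by blast
    then show "F \<in> (\<lambda>(i, b). Fac i b) ` UNIV" by auto
  next
    fix F assume "F \<in> (\<lambda>(i, b). Fac i b) ` UNIV"
    then obtain i b where F: "F = Fac i b" by auto
    \<comment> \<open>A vertex whose bit \<open>i\<close> is \<open>b\<close> shows that
      \<open>Fac i b\<close> is not the empty face, which is no facet.\<close>
    obtain v where v: "v extreme_point_of C" "bits v = (\<lambda>_. b)" using surj by blast
    have ne: "Fac i b \<noteq> {}" using vertex_Fac[OF v(1), of i b] v(2) by auto
    have "G = Fac i b \<or> G = C" if G: "G face_of C" "Fac i b \<subseteq> G" for G
    proof (rule disjCI)
      assume "G \<noteq> C"
      then obtain j b' where sub: "G \<subseteq> Fac j b'" using proper_face G(1) by blast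
      with G(2) have "Fac i b \<subseteq> Fac j b'" by (rule subset_trans)
      then have "G \<subseteq> Fac i b" using sub Fac_subset by simp
      then show "G = Fac i b" using G(2) by (rule subset_antisym)
    qed
    then show "F \<in> {F. F facet_of C}"
      using facet_of_iff_maximal_face[OF C ne] Fac_face Fac_proper F by simp
  qed
  have "cube_labelling C bits Fac"
  proof
    show "polytope C" by (fact C)
    have "inj_on bits {v. v extreme_point_of C}"
    proof (rule inj_onI)
      fix u v assume uv: "u \<in> {v. v extreme_point_of C}" "v \<in> {v. v extreme_point_of C}"
        and "bits u = bits v"
      then have eq: "f {u} = f {v}" using f_vertex[of u] f_vertex[of v] by simp
      have "g (f {u}) = {u}" "g (f {v}) = {v}"
        using uv by (simp_all add: g(2) face_of_singleton)
      then show "u = v" unfolding eq by simp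
    qed
    then show "bij_betw bits {v. v extreme_point_of C} UNIV"
      unfolding bij_betw_def using surj by (metis (mono_tags) UNIV_eq_I image_eqI mem_Collect_eq)
    have "inj (\<lambda>(i, b). Fac i b)"
    proof (rule injI, clarify)
      fix i b j b' assume "Fac i b = Fac j b'"
      then show "i = j \<and> b = b'" using Fac_subset[of i b j b'] by simp
    qed
    then show "bij_betw (\<lambda>(i, b). Fac i b) UNIV {F. F facet_of C}"
      by (simp add: bij_betw_def facets)
    show "v \<in> Fac i b \<longleftrightarrow> bits v i = b" if "v extreme_point_of C" for v i b
      using that by (rule vertex_Fac)
    show "v' \<in> F" if "F face_of C" "u extreme_point_of C" "v extreme_point_of C" "u \<in> F" "v \<in> F"
      "bits u i \<noteq> bits v i" "v' extreme_point_of C" "bits v' = (bits v)(i := bits u i)" for F u v i v'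
    proof -
      have "cube_vertex (bits u) \<in> f F" "cube_vertex (bits v) \<in> f F"
        using that mem_face_iff by auto
      then have "cube_vertex (bits v') \<in> f F"
        unfolding that(8) using face_isomorphism_face[OF f that(1)] that(6) by (intro cube_face_flip)
      then show ?thesis using mem_face_iff[OF that(7,1)] by simp
    qed
  qed
  then show ?thesis by blast
qed

section \<open>Monotone paths and Bland's rule on combinatorial cubes\<close>

context cube_labelling
begin

lemma bits_inject:
  assumes "u extreme_point_of C" "v extreme_point_of C" "bits u = bits v"
  shows "u = v"
  using inj_onD[OF bij_betw_imp_inj_on[OF bij_bits] assms(3)] assms(1,2) by simp

lemma vertex_with_bits: "\<exists>v. v extreme_point_of C \<and> bits v = s"
proof -
  have "s \<in> bits ` {v. v extreme_point_of C}" using bij_bits by (simp add: bij_betw_def)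
  then show ?thesis by blast
qed

text \<open>Every bit vector labels exactly one vertex, so the choice is determined. The facts about
  \<open>flip v i\<close> hold at every point \<open>v\<close>, as \<open>bits v\<close> is always a
  bit vector.\<close>

definition flip :: "'a \<Rightarrow> 'n \<Rightarrow> 'a" where
  "flip v i = (SOME u. u extreme_point_of C \<and> bits u = (bits v)(i := \<not> bits v i))"

lemma flip: "flip v i extreme_point_of C" "bits (flip v i) = (bits v)(i := \<not> bits v i)"
  using someI_ex[OF vertex_with_bits[of "(bits v)(i := \<not> bits v i)"]]
  by (simp_all add: flip_def)

lemma flip_neq: "flip v i \<noteq> v"
proof
  assume "flip v i = v"
  then have "bits v i = (\<not> bits v i)" using flip(2)[of v i] by (metis fun_upd_same)
  then show False by simp
qed

lemma Fac_facet: "Fac i b facet_of C"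
  using bij_betw_apply[OF bij_facets, of "(i, b)"] by simp

lemma Fac_face: "Fac i b face_of C"
  using Fac_facet by (simp add: facet_of_def)

text \<open>Fixing some bits of \<open>v\<close> cuts out a subcube: fixing all but one gives an
  edge, fixing those shared with \<open>w\<close> gives the face spanned by \<open>v\<close> and
  \<open>w\<close>. The intersection with \<open>C\<close> covers the case that no bit is
  fixed.\<close>

lemma common_facets_face:
  "C \<inter> \<Inter>{Fac i (bits v i) | i. P i} face_of C"
proof -
  have "\<Inter>(insert C {Fac i (bits v i) | i. P i}) face_of C"
    using Fac_face polytope polytope_imp_convex face_of_refl by (intro face_of_Inter) auto
  then show ?thesis by simp
qed

lemma vertex_in_common_facets_iff:
  assumes "u extreme_point_of C"
  shows "u \<in> C \<inter> \<Inter>{Fac i (bits v i) | i. P i} \<longleftrightarrow> (\<forall>i. P i \<longrightarrow> bits u i = bits v i)"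
proof -
  have "u \<in> C" using assms by (simp add: extreme_point_of_def)
  then show ?thesis using vertex_in_facet_iff[OF assms] by auto
qed

lemma adjacent_flip:
  assumes v: "v extreme_point_of C"
  shows "adjacent C v (flip v i)"
proof -
  let ?F = "C \<inter> \<Inter>{Fac j (bits v j) | j. j \<noteq> i}"
  have "u \<in> ?F \<longleftrightarrow> u = v \<or> u = flip v i" if u: "u extreme_point_of C" for u
  proof -
    have "u \<in> ?F \<longleftrightarrow> (\<forall>j. j \<noteq> i \<longrightarrow> bits u j = bits v j)"
      using u by (rule vertex_in_common_facets_iff)
    also have "\<dots> \<longleftrightarrow> bits u = bits v \<or> bits u = (bits v)(i := \<not> bits v i)"
      by (auto simp: fun_eq_iff)
    also have "\<dots> \<longleftrightarrow> u = v \<or> u = flip v i"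
      using bits_inject[OF u v] bits_inject[OF u flip(1)[of v i]] flip(2)[of v i] by auto
    finally show ?thesis .
  qed
  then have "{u. u extreme_point_of C \<and> u \<in> ?F} = {v, flip v i}"
    using v flip(1)[of v i] by blast
  with common_facets_face show ?thesis
    by (intro iffD2[OF adjacent_iff_face[OF polytope v flip(1) flip_neq[symmetric]]] exI conjI)
qed

text \<open>If the endpoints of an edge differ in bit \<open>i\<close>, \<open>face_flip\<close>
  puts \<open>flip v i\<close> on the edge too; as a vertex other than \<open>v\<close> it must be
  the other endpoint.\<close>

lemma adjacent_iff_flip:
  assumes v: "v extreme_point_of C"
  shows "adjacent C v u \<longleftrightarrow> (\<exists>i. u = flip v i)"
proof
  assume adj: "adjacent C v u"
  then have u: "u extreme_point_of C" and edge: "closed_segment v u face_of C"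
    and dim: "aff_dim (closed_segment v u) = 1"
    by (auto simp: adjacent_def edge_of_def)
  have "u \<noteq> v" using dim by auto
  then obtain i where i: "bits u i \<noteq> bits v i" using bits_inject[OF u v] by blast
  then have "bits (flip v i) = (bits v)(i := bits u i)" using flip(2)[of v i] by auto
  then have "flip v i \<in> closed_segment v u"
    using face_flip[OF edge u v _ _ i flip(1)] by simp
  then have "flip v i extreme_point_of closed_segment v u"
    using extreme_point_of_face[OF edge] flip(1) by blast
  then have "u = flip v i"
    using flip_neq by (auto simp: extreme_point_of_segment)
  then show "\<exists>i. u = flip v i" by blast
qed (auto simp: adjacent_flip[OF v])

text \<open>Flipping bit \<open>j\<close> leaves \<open>Fac i (bits v i)\<close> just when
  \<open>j = i\<close>, so the definite description has a unique witness.\<close>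

lemma entering_vertex_eq_flip:
  assumes v: "v extreme_point_of C"
  shows "entering_vertex C (Fac i (bits v i)) v = flip v i"
proof -
  have leaves: "\<not> closed_segment v (flip v j) \<subseteq> Fac i (bits v i) \<longleftrightarrow> j = i" for j
  proof -
    have "closed_segment v (flip v j) \<subseteq> Fac i (bits v i) \<longleftrightarrow>
        v \<in> Fac i (bits v i) \<and> flip v j \<in> Fac i (bits v i)"
      using closed_segment_subset[of v "Fac i (bits v i)" "flip v j"]
        face_of_imp_convex[OF Fac_face[of i "bits v i"]] ends_in_segment[of v "flip v j"]
      by blast
    then show ?thesis
      by (auto simp: vertex_in_facet_iff v flip)
  qed
  show ?thesis
    unfolding entering_vertex_def adjacent_iff_flip[OF v]
    by (rule the_equality) (use leaves in metis)+
qed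

text \<open>Apply the improving face not to \<open>C\<close> but to its smallest face containing \<open>v\<close> and \<open>w\<close>: flips
  inside that face only change coordinates in which \<open>v\<close> and \<open>w\<close> differ.\<close>

lemma improving_flip_towards:
  assumes v: "v extreme_point_of C" and w: "w extreme_point_of C" and less: "c \<bullet> w < c \<bullet> v"
  shows "\<exists>i. bits v i \<noteq> bits w i \<and> improving C c v (flip v i)"
proof -
  let ?G = "C \<inter> \<Inter>{Fac i (bits v i) | i. bits w i = bits v i}"
  have G: "?G face_of C" by (rule common_facets_face)
  have mem: "u \<in> ?G \<longleftrightarrow> (\<forall>i. bits w i = bits v i \<longrightarrow> bits u i = bits v i)"
    if "u extreme_point_of C" for u
    using that by (rule vertex_in_common_facets_iff)
  have pG: "polytope ?G" using polytope G face_of_polytope_polytope by blast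
  have vG: "v extreme_point_of ?G" using extreme_point_of_face[OF G] mem[OF v] v by simp
  have wG: "w \<in> ?G" using mem[OF w] by simp
  obtain E where E: "E face_of ?G" "v \<in> E" "E \<noteq> {v}"
      and imp: "\<forall>y\<in>E. y \<noteq> v \<longrightarrow> c \<bullet> y < c \<bullet> v"
    by (rule polytope_improving_face[OF pG vG wG less]) (rule that)
  have EC: "E face_of C" using face_of_trans[OF E(1) G] .
  have "\<exists>u. u extreme_point_of C \<and> u \<in> E \<and> u \<noteq> v"
  proof (rule ccontr)
    assume "\<not> ?thesis"
    then have "{u. u extreme_point_of C \<and> u \<in> E} = {v}" using v E(2) by blast
    then have "E = {v}" using polytope_face_eq_hull[OF polytope EC] by simp
    then show False using E(3) by contradiction
  qed
  then obtain u where u: "u extreme_point_of C" "u \<in> E" "u \<noteq> v" by blast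
  then obtain i where i: "bits u i \<noteq> bits v i" using bits_inject[OF u(1) v] by blast
  \<comment> \<open>Inside \<open>?G\<close> the bits shared by \<open>v\<close> and
    \<open>w\<close> are frozen, so the bit \<open>i\<close> in which \<open>u\<close> differs from
    \<open>v\<close> is not shared.\<close>
  have "u \<in> ?G" using u(2) face_of_imp_subset[OF E(1)] by (rule rev_subsetD)
  then have "bits v i \<noteq> bits w i" using mem[OF u(1)] i by metis
  \<comment> \<open>The vertex \<open>u\<close> need not be adjacent to \<open>v\<close>, but
    \<open>face_flip\<close> yields a neighbour of \<open>v\<close> in \<open>E\<close>, where every
    point other than \<open>v\<close> is better.\<close>
  moreover have "flip v i \<in> E"
    using face_flip[OF EC u(1) v u(2) E(2) i flip(1)] flip(2)[of v i] i by auto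
  then have "improving C c v (flip v i)"
    using imp flip_neq adjacent_flip[OF v] by (simp add: improving_def)
  ultimately show ?thesis by blast
qed

section \<open>Hamming distance between vertices\<close>

definition hamming :: "'a \<Rightarrow> 'a \<Rightarrow> nat" where
  "hamming v w = card {i. bits v i \<noteq> bits w i}"

lemma hamming_eq_0_iff:
  assumes "v extreme_point_of C" "w extreme_point_of C"
  shows "hamming v w = 0 \<longleftrightarrow> v = w"
proof -
  have "hamming v w = 0 \<longleftrightarrow> bits v = bits w" by (simp add: hamming_def fun_eq_iff)
  then show ?thesis using bits_inject[OF assms] by auto
qed

lemma hamming_flip_towards:
  assumes "bits v i \<noteq> bits w i"
  shows "hamming v w = Suc (hamming (flip v i) w)"
proof -
  have "{j. bits v j \<noteq> bits w j} = insert i {j. bits (flip v i) j \<noteq> bits w j}"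
    using assms by (auto simp: flip)
  moreover have "i \<notin> {j. bits (flip v i) j \<noteq> bits w j}"
    using assms by (auto simp: flip)
  ultimately show ?thesis by (simp add: hamming_def)
qed

text \<open>Bounds the progress made by an arbitrary edge, for the lower bound on path
  lengths.\<close>

lemma hamming_le_flip: "hamming v w \<le> Suc (hamming (flip v i) w)"
proof -
  have "{j. bits v j \<noteq> bits w j} \<subseteq> insert i {j. bits (flip v i) j \<noteq> bits w j}"
    by (auto simp: flip)
  then have "hamming v w \<le> card (insert i {j. bits (flip v i) j \<noteq> bits w j})"
    unfolding hamming_def by (intro card_mono) auto
  also have "\<dots> \<le> Suc (hamming (flip v i) w)"
    unfolding hamming_def by (rule card_insert_le_m1[THEN le_trans]) auto
  finally show ?thesis .
qed

lemma hamming_le_CARD: "hamming v w \<le> CARD('n)"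
  unfolding hamming_def by (rule card_mono) auto

lemma optimal_vertex_exists: "\<exists>w. optimal_vertex C c w"
proof -
  have "C \<noteq> {}" using vertex_with_bits by (metis extreme_point_of_empty)
  then obtain w where "w extreme_point_of C" "\<And>x. x \<in> C \<Longrightarrow> c \<bullet> w \<le> c \<bullet> x"
    using polytope_minimizing_vertex[OF polytope] by blast
  then show ?thesis by (auto simp: optimal_vertex_def)
qed

end

section \<open>Monotone distances and Bland's rule for a fixed objective\<close>

locale cube_labelling_objective = cube_labelling C bits Fac
  for C :: "'a::euclidean_space set" and bits :: "'a \<Rightarrow> 'n::finite \<Rightarrow> bool" and Fac +
  fixes c w :: 'a
  assumes nondegenerate: "nondegenerate C c" and optimal: "optimal_vertex C c w"
begin

lemma w_vertex: "w extreme_point_of C"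
  using optimal by (simp add: optimal_vertex_def)

lemma less_nonoptimal:
  assumes v: "v extreme_point_of C" and "v \<noteq> w"
  shows "c \<bullet> w < c \<bullet> v"
proof -
  have "c \<bullet> w \<le> c \<bullet> v"
    using optimal v by (simp add: optimal_vertex_def extreme_point_of_def)
  moreover have "c \<bullet> w \<noteq> c \<bullet> v"
    using nondegenerate v w_vertex \<open>v \<noteq> w\<close> by (auto simp: nondegenerate_def inj_on_def)
  ultimately show ?thesis by simp
qed

lemma optimal_vertex_iff: "optimal_vertex C c v \<longleftrightarrow> v = w"
proof
  assume v: "optimal_vertex C c v"
  then have "c \<bullet> v \<le> c \<bullet> w"
    using w_vertex by (simp add: optimal_vertex_def extreme_point_of_def)
  then show "v = w"
    using less_nonoptimal[of v] v by (force simp: optimal_vertex_def)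
qed (simp add: optimal)

text \<open>Induction on the Hamming distance to \<open>w\<close>, each time prepending an improving
  flip that corrects one bit.\<close>

lemma monotone_path_exists:
  assumes "v extreme_point_of C"
  shows "\<exists>p. monotone_path C c v p \<and> length p = Suc (hamming v w)"
  using assms
proof (induction "hamming v w" arbitrary: v)
  case 0
  then have "v = w" using hamming_eq_0_iff[OF 0(2) w_vertex] by simp
  then have "monotone_path C c v [v]"
    using optimal w_vertex by (simp add: monotone_path_def)
  then show ?case using 0 by (intro exI[of _ "[v]"]) simp
next
  case (Suc k)
  then have "v \<noteq> w" using hamming_eq_0_iff[OF Suc.prems w_vertex] by simp
  then obtain i where i: "bits v i \<noteq> bits w i" "improving C c v (flip v i)"
    using improving_flip_towards[OF Suc.prems w_vertex less_nonoptimal[OF Suc.prems]] by blast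
  then have k: "k = hamming (flip v i) w"
    using Suc.hyps(2) hamming_flip_towards[OF i(1)] by simp
  then obtain p where p: "monotone_path C c (flip v i) p" "length p = Suc k"
    using Suc.hyps(1) flip(1) by metis
  have "monotone_path C c v (v # p)"
    using p(1) i(2) Suc.prems by (auto simp: monotone_path_def successively_Cons)
  then show ?case using p(2) Suc.hyps(2) by (intro exI[of _ "v # p"]) simp
qed

text \<open>An edge flips a single bit, so the distance to the last vertex drops by at most one per
  edge; \<open>Suc\<close> appears because \<open>p\<close> lists vertices, one more than its
  edges.\<close>

lemma successively_improving_length:
  assumes "successively (improving C c) p" "p \<noteq> []"
  shows "Suc (hamming (hd p) (last p)) \<le> length p"
  using assms
proof (induction p rule: induct_list012)
  case (3 v u p)
  then have "adjacent C v u" by (simp add: improving_def)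
  then obtain i where "u = flip v i"
    using adjacent_iff_flip by (auto simp: adjacent_def)
  then have "hamming v (last (u # p)) \<le> Suc (hamming u (last (u # p)))"
    using hamming_le_flip by simp
  then show ?case using 3 by simp
qed (auto simp: hamming_def)

lemma monotone_distance_eq_hamming:
  assumes v: "v extreme_point_of C"
  shows "monotone_distance C c v = hamming v w"
  unfolding monotone_distance_def
proof (rule Least_equality)
  show "\<exists>p. monotone_path C c v p \<and> length p = Suc (hamming v w)"
    using v by (rule monotone_path_exists)
  fix k assume "\<exists>p. monotone_path C c v p \<and> length p = Suc k"
  then obtain p where "monotone_path C c v p" "length p = Suc k" by blast
  then show "hamming v w \<le> k"
    using successively_improving_length[of p] by (simp add: monotone_path_def optimal_vertex_iff)
qed

lemma monotone_diameter_eq: "monotone_diameter C c = CARD('n)"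
  unfolding monotone_diameter_def
proof (rule Max_eqI)
  show "finite (monotone_distance C c ` {x. x extreme_point_of C})"
    using polytope by (simp add: finite_extreme_points_polytope)
  fix k assume "k \<in> monotone_distance C c ` {x. x extreme_point_of C}"
  then show "k \<le> CARD('n)"
    using monotone_distance_eq_hamming hamming_le_CARD by auto
next
  \<comment> \<open>The vertex antipodal to \<open>w\<close> attains the bound, since all its bits
    differ from those of \<open>w\<close>.\<close>
  obtain v where v: "v extreme_point_of C" "bits v = (\<lambda>i. \<not> bits w i)"
    using vertex_with_bits by blast
  then have "monotone_distance C c v = CARD('n)"
    using monotone_distance_eq_hamming by (simp add: hamming_def)
  then show "CARD('n) \<in> monotone_distance C c ` {x. x extreme_point_of C}"
    using v(1) by (metis (mono_tags) image_eqI mem_Collect_eq)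
qed

text \<open>The first block of \<open>Fs\<close> consists of the facets missing \<open>w\<close>;
  those among them containing \<open>v\<close> correspond to the wrong bits of \<open>v\<close>.
  Some wrong bit has an improving flip, so the smallest eligible index falls into this
  block.\<close>

lemma bland_step_flips_towards:
  assumes xs: "set xs = UNIV" and Fs: "Fs = map (\<lambda>i. Fac i (\<not> bits w i)) xs @ Gs"
    and v: "v extreme_point_of C" "v \<noteq> w"
  shows "\<exists>i. bits v i \<noteq> bits w i \<and> bland_step C c Fs v = flip v i"
proof -
  let ?P = "\<lambda>k. k < length Fs \<and> v \<in> Fs ! k \<and> improving C c v (entering_vertex C (Fs ! k) v)"
  have nth: "Fs ! k = Fac (xs ! k) (\<not> bits w (xs ! k))" if "k < length xs" for k
    using that by (simp add: Fs nth_append)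
  obtain i where i: "bits v i \<noteq> bits w i" "improving C c v (flip v i)"
    using improving_flip_towards[OF v(1) w_vertex less_nonoptimal[OF v]] by blast
  obtain j where j: "j < length xs" "xs ! j = i"
    using xs by (metis UNIV_I in_set_conv_nth)
  have "Fs ! j = Fac i (bits v i)" using i(1) j nth by simp
  then have Pj: "?P j"
    using i(2) j(1) v(1) entering_vertex_eq_flip[OF v(1), of i]
    by (simp add: Fs vertex_in_facet_iff)
  define k where "k = bland_index C c Fs v"
  have Pk: "?P k" unfolding k_def bland_index_def using Pj by (rule LeastI)
  \<comment> \<open>Minimality gives \<open>k \<le> j < length xs\<close>, so Bland's choice also
    stays in the first block.\<close>
  have "k \<le> j" unfolding k_def bland_index_def using Pj by (rule Least_le)
  then have k: "Fs ! k = Fac (xs ! k) (\<not> bits w (xs ! k))" using nth j(1) by simp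
  then have bit: "bits v (xs ! k) = (\<not> bits w (xs ! k))"
    using Pk vertex_in_facet_iff[OF v(1)] by simp
  then have "bland_step C c Fs v = flip v (xs ! k)"
    using entering_vertex_eq_flip[OF v(1), of "xs ! k"] k v(2)
    by (simp add: bland_step_def optimal_vertex_iff flip: k_def)
  then show ?thesis using bit by blast
qed

text \<open>Each pivot corrects one wrong bit and spoils none, so the number of pivots is the
  Hamming distance.\<close>

lemma bland_reaches_optimum:
  assumes "set xs = UNIV" "Fs = map (\<lambda>i. Fac i (\<not> bits w i)) xs @ Gs" "v extreme_point_of C"
  shows "(bland_step C c Fs ^^ hamming v w) v = w"
  using assms(3)
proof (induction "hamming v w" arbitrary: v)
  case 0
  then have "v = w" using hamming_eq_0_iff[OF 0(2) w_vertex] by simp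
  then show ?case by (simp add: hamming_def)
next
  case (Suc k)
  then have "v \<noteq> w" using hamming_eq_0_iff[OF Suc.prems w_vertex] by simp
  then obtain i where i: "bits v i \<noteq> bits w i" "bland_step C c Fs v = flip v i"
    using bland_step_flips_towards[OF assms(1,2) Suc.prems] by blast
  then have k: "k = hamming (flip v i) w"
    using Suc.hyps(2) hamming_flip_towards[OF i(1)] by simp
  then have "(bland_step C c Fs ^^ k) (flip v i) = w"
    using Suc.hyps(1) flip(1) by metis
  then show ?case by (simp add: Suc.hyps(2)[symmetric] funpow_Suc_right i(2) del: funpow.simps)
qed

lemma bland_ordering_exists:
  "\<exists>Fs. facet_ordering C Fs \<and> length Fs = 2 * CARD('n) \<and>
    (\<forall>x. x extreme_point_of C \<longrightarrow>
      (\<exists>k\<le>CARD('n). optimal_vertex C c ((bland_step C c Fs ^^ k) x)))"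
proof -
  obtain xs :: "'n list" where xs: "set xs = UNIV" "distinct xs"
    using finite_distinct_list[of "UNIV :: 'n set"] by auto
  \<comment> \<open>Facets missing \<open>w\<close> come first, facets through \<open>w\<close>
    last. The pairs enumerate all of \<open>'n \<times> bool\<close>, so \<open>bij_facets\<close>
    makes \<open>Fs\<close> list each facet once.\<close>
  define ps where "ps = map (\<lambda>i. (i, \<not> bits w i)) xs @ map (\<lambda>i. (i, bits w i)) xs"
  define Fs where "Fs = map (\<lambda>(i, b). Fac i b) ps"
  have ps: "distinct ps" "set ps = UNIV"
    using xs by (auto simp: ps_def distinct_map inj_on_def)
  have "distinct Fs" "set Fs = {F. F facet_of C}"
    using ps bij_facets by (auto simp: Fs_def distinct_map bij_betw_def)
  then have "facet_ordering C Fs" by (simp add: facet_ordering_def)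
  moreover have "length Fs = 2 * CARD('n)"
    using distinct_card[OF xs(2)] xs(1) by (simp add: Fs_def ps_def)
  moreover have "Fs = map (\<lambda>i. Fac i (\<not> bits w i)) xs @ map (\<lambda>i. Fac i (bits w i)) xs"
    by (simp add: Fs_def ps_def)
  then have "\<exists>k\<le>CARD('n). optimal_vertex C c ((bland_step C c Fs ^^ k) x)"
    if "x extreme_point_of C" for x
    using bland_reaches_optimum[OF xs(1) _ that] hamming_le_CARD optimal by metis
  ultimately show ?thesis by blast
qed

end

theorem theorem2p1:
  fixes C :: "(real ^ 'n) set"
  assumes "polytope C"
    and "combinatorially_equivalent C (cbox 0 1 :: (real ^ 'n) set)"
  shows "mono_diam C = CARD('n) \<and>
    (\<forall>c. nondegenerate C c \<longrightarrow>
      (\<exists>Fs. facet_ordering C Fs \<and> length Fs = 2 * CARD('n) \<and>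
        (\<forall>x. x extreme_point_of C \<longrightarrow>
          (\<exists>k\<le>CARD('n). optimal_vertex C c ((bland_step C c Fs ^^ k) x)))))"
proof -
  obtain bits :: "real ^ 'n \<Rightarrow> 'n \<Rightarrow> bool" and Fac where "cube_labelling C bits Fac"
    using cube_labelling_exists[OF assms] by blast
  then interpret cube_labelling C bits Fac .
  have objective: "\<exists>w. cube_labelling_objective C bits Fac c w" if "nondegenerate C c" for c
    using that optimal_vertex_exists[of c] cube_labelling_axioms
    by (auto simp: cube_labelling_objective_def cube_labelling_objective_axioms_def)
  have diameter: "monotone_diameter C c = CARD('n)" if "nondegenerate C c" for c
    using objective[OF that] cube_labelling_objective.monotone_diameter_eq by blast
  \<comment> \<open>All nondegenerate objectives give the same diameter; the existence of one makes
    the set of diameters a singleton rather than empty.\<close>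
  obtain c0 where "nondegenerate C c0" using nondegenerate_exists[OF assms(1)] by blast
  then have "monotone_diameter C ` {c. nondegenerate C c} = {CARD('n)}"
    using diameter by auto
  then have "mono_diam C = CARD('n)" by (simp add: mono_diam_def)
  moreover have "\<exists>Fs. facet_ordering C Fs \<and> length Fs = 2 * CARD('n) \<and>
      (\<forall>x. x extreme_point_of C \<longrightarrow>
        (\<exists>k\<le>CARD('n). optimal_vertex C c ((bland_step C c Fs ^^ k) x)))"
    if "nondegenerate C c" for c
    using objective[OF that] cube_labelling_objective.bland_ordering_exists by blast
  ultimately show ?thesis by blast
qed

end
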